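(* Let $x_0\in\mathbb{R}$, let $q\in C^0[x_0,\infty)$ be real-valued, and suppose that the equation $y''+q(x)y=0$ on $[x_0,\infty)$ is oscillatory. Let $y_1,y_2$ be a pair of linearly independent real solutions normalized by $|w(y_1,y_2)|=1$. Let $v(x)=y_1^2(x)+y_2^2(x)$ and suppose that $$\lim_{x\to\infty}v'(x)=K\quad\text{for some } K \text{ with } 0\le K<\infty .$$ Then the pair $y_1,y_2$ is unique up to orthogonal transformation. That is, if $\overline{y}_1,\overline{y}_2$ is any pair of linearly independent real solutions of the same equation with $|w(\overline{y}_1,\overline{y}_2)|=1$ such that $\lim_{x\to\infty}(\overline{y}_1^2+\overline{y}_2^2)'(x)=\overline{K}$ for some $\overline{K}$ with $0\le\overline{K}<\infty$, then there is a real $2\times 2$ matrix $A$ with $A^TA=I$ such that $$\begin{pmatrix}\overline{y}_1\\ \overline{y}_2\end{pmatrix}=A\begin{pmatrix}y_1\\ y_2\end{pmatrix}\quad\text{on }[x_0,\infty).$$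
   Context: The equation $y''+q(x)y=0$ on $[x_0,\infty)$ is called oscillatory if its nontrivial solutions have zeros accumulating at $+\infty$ (arbitrarily large zeros). The Wronskian of two solutions is $w(y_1,y_2)=y_1(x)y_2'(x)-y_1'(x)y_2(x)$, which is constant in $x$. *)

theory Defs
  imports "HOL-Analysis.Analysis"
begin

text \<open>
  All functions on the half-line \<open>[x\<^sub>0,\<infinity>)\<close> are represented by total functions
  on \<^typ>\<open>real\<close> whose values to the left of \<open>x\<^sub>0\<close> are irrelevant: derivatives are taken
  within \<^term>\<open>{x0::real..}\<close>, so the derivative at \<open>x\<^sub>0\<close> itself is one-sided.
\<close>

definition dhl :: "real \<Rightarrow> (real \<Rightarrow> real) \<Rightarrow> real \<Rightarrow> real" where
  "dhl x0 f x = vector_derivative f (at x within {x0..})"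

lemma dhl_eqI:
  assumes "(f has_real_derivative D) (at x within {x0..})" "x0 \<le> x"
  shows "dhl x0 f x = D"
proof -
  have "at x within {x0..} \<noteq> bot"
  proof -
    have "at x within {x<..} \<le> at x within {x0..}"
      using assms(2) by (intro at_le) auto
    then show ?thesis
      using trivial_limit_at_right_real[of x] by (metis bot.extremum_uniqueI)
  qed
  then show ?thesis
    using assms(1) unfolding dhl_def has_real_derivative_iff_has_vector_derivative
    by (rule vector_derivative_within)
qed

text \<open>
  Real (classical) solutions of \<open>y'' + q y = 0\<close> on \<open>[x\<^sub>0,\<infinity>)\<close>.
\<close>

definition is_solution :: "real \<Rightarrow> (real \<Rightarrow> real) \<Rightarrow> (real \<Rightarrow> real) \<Rightarrow> bool" where
  "is_solution x0 q y \<longleftrightarrow>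
     (\<forall>x\<ge>x0. y differentiable (at x within {x0..})) \<and>
     (\<forall>x\<ge>x0. dhl x0 y differentiable (at x within {x0..})) \<and>
     (\<forall>x\<ge>x0. dhl x0 (dhl x0 y) x + q x * y x = 0)"

definition oscillatory :: "real \<Rightarrow> (real \<Rightarrow> real) \<Rightarrow> bool" where
  "oscillatory x0 q \<longleftrightarrow>
     (\<forall>y. is_solution x0 q y \<and> (\<exists>x\<ge>x0. y x \<noteq> 0) \<longrightarrow> (\<forall>X. \<exists>x\<ge>X. x0 \<le> x \<and> y x = 0))"

definition lin_indep_pair :: "real \<Rightarrow> (real \<Rightarrow> real) \<Rightarrow> (real \<Rightarrow> real) \<Rightarrow> bool" where
  "lin_indep_pair x0 f g \<longleftrightarrow>
     (\<forall>a b :: real. (\<forall>x\<ge>x0. a * f x + b * g x = 0) \<longrightarrow> a = 0 \<and> b = 0)"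

definition wronskian :: "real \<Rightarrow> (real \<Rightarrow> real) \<Rightarrow> (real \<Rightarrow> real) \<Rightarrow> real \<Rightarrow> real" where
  "wronskian x0 f g x = f x * dhl x0 g x - dhl x0 f x * g x"

text \<open>
  The Wronskian of two solutions is constant, so its normalization may be required at every
  point of the half-line.
\<close>

definition normalized_pair ::
  "real \<Rightarrow> (real \<Rightarrow> real) \<Rightarrow> (real \<Rightarrow> real) \<Rightarrow> (real \<Rightarrow> real) \<Rightarrow> bool" where
  "normalized_pair x0 q f g \<longleftrightarrow>
     is_solution x0 q f \<and> is_solution x0 q g \<and> lin_indep_pair x0 f g \<and>
     (\<forall>x\<ge>x0. \<bar>wronskian x0 f g x\<bar> = 1)"

end

theory Submission
  imports Defs
begin

text \<open>
  Two linearly independent solutions span all solutions, so \<open>z = M y\<close> for a constant matrix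
  \<open>M\<close>, and comparing Wronskians gives \<open>(det M)\<^sup>2 = 1\<close>. The point is that the symmetric matrix
  \<open>S = M\<^sup>T M\<close>, with entries \<open>a, b, b, c\<close> and determinant \<open>1\<close>, is the identity.

  Let \<open>v = \<bar>y\<bar>\<^sup>2\<close> and \<open>u = \<bar>z\<bar>\<^sup>2\<close>, so that \<open>v' = 2 y \<bullet> y'\<close> and \<open>u' = 2 y \<bullet> S y'\<close>. When \<open>y(x)\<close> is
  parallel to a direction \<open>d\<close>, the component of \<open>y'\<close> along \<open>d\<close> is determined by \<open>v'\<close> and the
  component along the rotated vector \<open>d\<^sup>\<bottom>\<close> by the Wronskian \<open>w\<close>, whence
  \<open>\<bar>d\<bar>\<^sup>2 u' = (d \<bullet> S d) v' + 2 w (d \<bullet> S d\<^sup>\<bottom>)\<close>. Oscillation makes \<open>y\<close> parallel to \<open>d\<close> at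
  arbitrarily large \<open>x\<close>, so this relation persists in the limit, for every \<open>d\<close>
  (\<open>limit_relation\<close>). The directions \<open>(1,0)\<close>, \<open>(0,1)\<close>, \<open>(1,1)\<close>, \<open>(1,-1)\<close> yield
  \<open>(c - a) K = 4 b w\<close> and \<open>(c - a) w = - b K\<close>; since \<open>w\<^sup>2 = 1\<close> this is a linear system with
  determinant \<open>K\<^sup>2 + 4\<close> in \<open>c - a\<close> and \<open>b\<close>, which forces \<open>b = 0\<close> and \<open>a = c\<close>, and then \<open>det S = 1\<close> gives
  \<open>a = c = 1\<close>.
\<close>

lemma is_solution_derivs:
  assumes "is_solution x0 q y" "x0 \<le> x"
  shows "(y has_real_derivative dhl x0 y x) (at x within {x0..})"
    and "(dhl x0 y has_real_derivative - (q x * y x)) (at x within {x0..})"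
proof -
  have has_dhl: "(f has_real_derivative dhl x0 f x) (at x within {x0..})"
    if "f differentiable (at x within {x0..})" for f
    using that \<open>x0 \<le> x\<close> dhl_eqI by (metis real_differentiable_def)
  show "(y has_real_derivative dhl x0 y x) (at x within {x0..})"
    using assms has_dhl unfolding is_solution_def by blast
  have "dhl x0 (dhl x0 y) x + q x * y x = 0"
    using assms unfolding is_solution_def by blast
  then have "dhl x0 (dhl x0 y) x = - (q x * y x)"
    by linarith
  then show "(dhl x0 y has_real_derivative - (q x * y x)) (at x within {x0..})"
    using assms has_dhl[of "dhl x0 y"] unfolding is_solution_def by auto
qed

lemma dhl_linear_combination:
  assumes "is_solution x0 q f" "is_solution x0 q g" "x0 \<le> x"
  shows "dhl x0 (\<lambda>x. s * f x + t * g x) x = s * dhl x0 f x + t * dhl x0 g x"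
  by (rule dhl_eqI[OF _ \<open>x0 \<le> x\<close>])
    (use assms in \<open>auto intro!: derivative_eq_intros is_solution_derivs(1)\<close>)

lemma is_solution_linear_combination:
  assumes f: "is_solution x0 q f" and g: "is_solution x0 q g"
  shows "is_solution x0 q (\<lambda>x. s * f x + t * g x)" (is "is_solution x0 q ?h")
proof -
  have 1: "(?h has_real_derivative s * dhl x0 f x + t * dhl x0 g x) (at x within {x0..})"
    if "x0 \<le> x" for x
    using that f g by (auto intro!: derivative_eq_intros is_solution_derivs(1))
  have 2: "(dhl x0 ?h has_real_derivative - (q x * ?h x)) (at x within {x0..})"
    if "x0 \<le> x" for x
  proof -
    have "((\<lambda>x. s * dhl x0 f x + t * dhl x0 g x) has_real_derivative - (q x * ?h x))
        (at x within {x0..})"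
      using that f g
      by (auto intro!: derivative_eq_intros is_solution_derivs(2) simp: algebra_simps)
    then show ?thesis
      by (rule has_field_derivative_transform_within[where d = 1])
        (use that f g in \<open>auto simp: dhl_linear_combination\<close>)
  qed
  show ?thesis
    unfolding is_solution_def
  proof (intro conjI allI impI)
    fix x assume x: "x0 \<le> x"
    show "?h differentiable (at x within {x0..})"
      using 1[OF x] real_differentiable_def by blast
    show "dhl x0 ?h differentiable (at x within {x0..})"
      using 2[OF x] real_differentiable_def by blast
    show "dhl x0 (dhl x0 ?h) x + q x * ?h x = 0"
      using dhl_eqI[OF 2[OF x] x] by simp
  qed
qed

lemma wronskian_constant:
  assumes "is_solution x0 q f" "is_solution x0 q g" "x0 \<le> x"
  shows "wronskian x0 f g x = wronskian x0 f g x0"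
proof -
  have "(wronskian x0 f g has_real_derivative 0) (at u within {x0..})" if "u \<in> {x0..}" for u
    unfolding wronskian_def using that assms
    by (auto intro!: derivative_eq_intros is_solution_derivs)
  then obtain k where "\<And>u. u \<in> {x0..} \<Longrightarrow> wronskian x0 f g u = k"
    using has_field_derivative_zero_constant[of "{x0..}" "wronskian x0 f g"] by auto
  then show ?thesis
    using assms(3) by simp
qed

text \<open>
  The coefficients come from Cramer's rule for \<open>h\<close> and \<open>h'\<close>, which involves only Wronskians, so
  constancy of Wronskians takes the place of a uniqueness theorem for initial value problems.
\<close>

lemma solution_in_span:
  assumes f: "is_solution x0 q f" and g: "is_solution x0 q g" and h: "is_solution x0 q h"
    and w: "wronskian x0 f g x0 \<noteq> 0"
  obtains s t where "\<And>x. x0 \<le> x \<Longrightarrow> h x = s * f x + t * g x"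
    and "\<And>x. x0 \<le> x \<Longrightarrow> dhl x0 h x = s * dhl x0 f x + t * dhl x0 g x"
proof
  define w where "w = wronskian x0 f g x0"
  define s where "s = wronskian x0 h g x0 / w"
  define t where "t = wronskian x0 f h x0 / w"
  have "w \<noteq> 0"
    using w by (simp add: w_def)
  show "h x = s * f x + t * g x" "dhl x0 h x = s * dhl x0 f x + t * dhl x0 g x"
    if x: "x0 \<le> x" for x
  proof -
    have e: "f x * dhl x0 g x - dhl x0 f x * g x = w"
      "h x * dhl x0 g x - dhl x0 h x * g x = w * s"
      "f x * dhl x0 h x - dhl x0 f x * h x = w * t"
      using wronskian_constant[OF f g x] wronskian_constant[OF h g x]
        wronskian_constant[OF f h x] \<open>w \<noteq> 0\<close>
      by (simp_all add: wronskian_def w_def s_def t_def)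
    have "w * h x = (w * s) * f x + (w * t) * g x"
      unfolding e(2,3)[symmetric] unfolding e(1)[symmetric] by (simp add: algebra_simps)
    then have "w * h x = w * (s * f x + t * g x)"
      by (simp add: algebra_simps)
    moreover have "w * dhl x0 h x = (w * s) * dhl x0 f x + (w * t) * dhl x0 g x"
      unfolding e(2,3)[symmetric] unfolding e(1)[symmetric] by (simp add: algebra_simps)
    then have "w * dhl x0 h x = w * (s * dhl x0 f x + t * dhl x0 g x)"
      by (simp add: algebra_simps)
    ultimately show "h x = s * f x + t * g x" "dhl x0 h x = s * dhl x0 f x + t * dhl x0 g x"
      using \<open>w \<noteq> 0\<close> by simp_all
  qed
qed

lemma dhl_sum_of_squares:
  assumes "is_solution x0 q f" "is_solution x0 q g" "x0 \<le> x"
  shows "dhl x0 (\<lambda>x. (f x)\<^sup>2 + (g x)\<^sup>2) x = 2 * (f x * dhl x0 f x + g x * dhl x0 g x)"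
  by (rule dhl_eqI[OF _ \<open>x0 \<le> x\<close>])
    (use assms in \<open>auto intro!: derivative_eq_intros is_solution_derivs(1)\<close>)

lemma limit_of_frequently_zero:
  fixes F :: "real \<Rightarrow> real"
  assumes "(F \<longlongrightarrow> L) at_top" "\<And>X. \<exists>x\<ge>X. F x = 0"
  shows "L = 0"
proof (rule ccontr)
  assume "L \<noteq> 0"
  then obtain N where "\<And>x. x \<ge> N \<Longrightarrow> F x \<noteq> 0"
    using tendsto_imp_eventually_ne[OF assms(1)] by (auto simp: eventually_at_top_linorder)
  then show False
    using assms(2) by blast
qed

lemma oscillatory_parallel:
  assumes osc: "oscillatory x0 q" and np: "normalized_pair x0 q y1 y2"
    and d: "(p, r) \<noteq> (0, 0)"
  shows "\<exists>x\<ge>X. x0 \<le> x \<and> r * y1 x = p * y2 x"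
proof -
  have "is_solution x0 q (\<lambda>x. r * y1 x + (- p) * y2 x)"
    using np unfolding normalized_pair_def by (intro is_solution_linear_combination) auto
  moreover have "\<exists>x\<ge>x0. r * y1 x + (- p) * y2 x \<noteq> 0"
    using np d unfolding normalized_pair_def lin_indep_pair_def
    by (metis neg_equal_0_iff_equal)
  ultimately obtain x where "x \<ge> X" "x0 \<le> x" "r * y1 x + (- p) * y2 x = 0"
    using osc unfolding oscillatory_def by blast
  then show ?thesis
    by auto
qed

text \<open>
  Here \<open>d = (p, r)\<close>, \<open>d\<^sup>\<bottom> = (-r, p)\<close>, and \<open>U\<close> is \<open>u' = 2 y \<bullet> S y'\<close>. At the points where \<open>y\<close> is
  parallel to \<open>d\<close> the asserted relation holds with \<open>u'\<close>, \<open>v'\<close> in place of \<open>L\<close>, \<open>K\<close>, and such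
  points are arbitrarily large.
\<close>

lemma limit_relation:
  fixes U :: "real \<Rightarrow> real"
  assumes osc: "oscillatory x0 q" and np: "normalized_pair x0 q y1 y2"
    and v: "(dhl x0 (\<lambda>x. (y1 x)\<^sup>2 + (y2 x)\<^sup>2) \<longlongrightarrow> K) at_top"
    and u: "(U \<longlongrightarrow> L) at_top"
    and U: "\<And>x. x0 \<le> x \<Longrightarrow> U x = 2 * (y1 x * (a * dhl x0 y1 x + b * dhl x0 y2 x)
                                      + y2 x * (b * dhl x0 y1 x + c * dhl x0 y2 x))"
    and d: "(p, r) \<noteq> (0, 0)"
  shows "(p\<^sup>2 + r\<^sup>2) * L = (a * p\<^sup>2 + 2 * b * p * r + c * r\<^sup>2) * K
           + 2 * wronskian x0 y1 y2 x0 * ((c - a) * p * r + b * (p\<^sup>2 - r\<^sup>2))"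
proof -
  define w where "w = wronskian x0 y1 y2 x0"
  define V where "V = dhl x0 (\<lambda>x. (y1 x)\<^sup>2 + (y2 x)\<^sup>2)"
  define F where "F x = (p\<^sup>2 + r\<^sup>2) * U x - (a * p\<^sup>2 + 2 * b * p * r + c * r\<^sup>2) * V x
           - 2 * w * ((c - a) * p * r + b * (p\<^sup>2 - r\<^sup>2))" for x
  have s: "is_solution x0 q y1" "is_solution x0 q y2"
    using np unfolding normalized_pair_def by auto
  have "\<exists>x\<ge>X. F x = 0" for X
  proof -
    obtain x where x: "x \<ge> X" "x0 \<le> x" "r * y1 x = p * y2 x"
      using oscillatory_parallel[OF osc np d] by blast
    have "p\<^sup>2 + r\<^sup>2 \<noteq> 0"
      using d by (auto simp: sum_power2_eq_zero_iff)
    define t where "t = (p * y1 x + r * y2 x) / (p\<^sup>2 + r\<^sup>2)"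
    have "(p\<^sup>2 + r\<^sup>2) * y1 x = p * (p * y1 x + r * y2 x)"
      using x(3) by algebra
    moreover have "(p\<^sup>2 + r\<^sup>2) * y2 x = r * (p * y1 x + r * y2 x)"
      using x(3) by algebra
    ultimately have y: "y1 x = t * p" "y2 x = t * r"
      using \<open>p\<^sup>2 + r\<^sup>2 \<noteq> 0\<close> by (simp_all add: t_def divide_simps mult_ac)
    have W: "w = y1 x * dhl x0 y2 x - dhl x0 y1 x * y2 x"
      using wronskian_constant[OF s x(2)] by (simp add: w_def wronskian_def)
    have "F x = 0"
      unfolding F_def V_def dhl_sum_of_squares[OF s x(2)] U[OF x(2)] W y
      by algebra
    then show ?thesis
      using x(1) by blast
  qed
  moreover have "(F \<longlongrightarrow> (p\<^sup>2 + r\<^sup>2) * L - (a * p\<^sup>2 + 2 * b * p * r + c * r\<^sup>2) * K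
           - 2 * w * ((c - a) * p * r + b * (p\<^sup>2 - r\<^sup>2))) at_top"
    unfolding F_def V_def by (intro tendsto_intros u v)
  ultimately show ?thesis
    using limit_of_frequently_zero unfolding w_def by fastforce
qed

text \<open>
  Only four directions are needed: \<open>d \<bullet> S d\<close> and \<open>d \<bullet> S d\<^sup>\<bottom>\<close> are, for unit \<open>d\<close> at angle \<open>\<theta>\<close>,
  trigonometric polynomials in \<open>2\<theta>\<close>, and opposite values of \<open>(cos 2\<theta>, sin 2\<theta>)\<close> isolate their
  nonconstant parts.
\<close>

lemma identity_from_four_directions:
  fixes a b c w K L :: real
  assumes w: "\<bar>w\<bar> = 1" and det: "a * c - b\<^sup>2 = 1" and a: "0 \<le> a"
    and rel: "\<And>p r. (p, r) \<noteq> (0, 0) \<Longrightarrow>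
      (p\<^sup>2 + r\<^sup>2) * L = (a * p\<^sup>2 + 2 * b * p * r + c * r\<^sup>2) * K
         + 2 * w * ((c - a) * p * r + b * (p\<^sup>2 - r\<^sup>2))"
  shows "a = 1" "b = 0" "c = 1"
proof -
  have e: "L = a * K + 2 * w * b" "L = c * K - 2 * w * b"
    "2 * L = (a + 2 * b + c) * K + 2 * w * (c - a)"
    "2 * L = (a - 2 * b + c) * K - 2 * w * (c - a)"
    using rel[of 1 0] rel[of 0 1] rel[of 1 1] rel[of 1 "-1"] by (simp_all add: algebra_simps)
  have w2: "w\<^sup>2 = 1"
    using w by (simp add: abs_square_eq_1)
  have eq: "(c - a) * K = 4 * (b * w)" "(c - a) * w = - (b * K)"
    using e by (simp_all add: algebra_simps)
  then have "b * (4 * w\<^sup>2 + K\<^sup>2) = 0"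
    by algebra
  moreover have "4 * w\<^sup>2 + K\<^sup>2 > 0"
    using w2 by (simp add: add_pos_nonneg)
  ultimately show b: "b = 0"
    by simp
  have "w \<noteq> 0"
    using w by auto
  with eq(2) b have "c = a"
    by simp
  with det b have "a\<^sup>2 = 1"
    by (simp add: power2_eq_square)
  with a show "a = 1"
    by (simp add: power2_eq_1_iff)
  with \<open>c = a\<close> show "c = 1"
    by simp
qed

theorem theorem1:
  fixes x0 K K' :: real and q y1 y2 z1 z2 :: "real \<Rightarrow> real"
  assumes "continuous_on {x0..} q"
    and "oscillatory x0 q"
    and "normalized_pair x0 q y1 y2"
    and "(dhl x0 (\<lambda>x. (y1 x)\<^sup>2 + (y2 x)\<^sup>2) \<longlongrightarrow> K) at_top" and "0 \<le> K"
    and "normalized_pair x0 q z1 z2"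
    and "(dhl x0 (\<lambda>x. (z1 x)\<^sup>2 + (z2 x)\<^sup>2) \<longlongrightarrow> K') at_top" and "0 \<le> K'"
  shows "\<exists>A :: real ^ 2 ^ 2. transpose A ** A = mat 1 \<and>
           (\<forall>x\<ge>x0. (vector [z1 x, z2 x] :: real ^ 2) = A *v vector [y1 x, y2 x])"
proof -
  define w where "w = wronskian x0 y1 y2 x0"
  have y: "is_solution x0 q y1" "is_solution x0 q y2"
    and z: "is_solution x0 q z1" "is_solution x0 q z2"
    and wy: "\<bar>w\<bar> = 1" and wz: "\<bar>wronskian x0 z1 z2 x0\<bar> = 1"
    using assms(3,6) unfolding normalized_pair_def w_def by auto
  have nz: "wronskian x0 y1 y2 x0 \<noteq> 0"
    using wy w_def by auto
  obtain m11 m12 where z1: "\<And>x. x0 \<le> x \<Longrightarrow> z1 x = m11 * y1 x + m12 * y2 x"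
    "\<And>x. x0 \<le> x \<Longrightarrow> dhl x0 z1 x = m11 * dhl x0 y1 x + m12 * dhl x0 y2 x"
    using solution_in_span[OF y z(1) nz] by metis
  obtain m21 m22 where z2: "\<And>x. x0 \<le> x \<Longrightarrow> z2 x = m21 * y1 x + m22 * y2 x"
    "\<And>x. x0 \<le> x \<Longrightarrow> dhl x0 z2 x = m21 * dhl x0 y1 x + m22 * dhl x0 y2 x"
    using solution_in_span[OF y z(2) nz] by metis
  define a where "a = m11\<^sup>2 + m21\<^sup>2"
  define b where "b = m11 * m12 + m21 * m22"
  define c where "c = m12\<^sup>2 + m22\<^sup>2"
  have "wronskian x0 z1 z2 x0 = (m11 * m22 - m12 * m21) * w"
    unfolding w_def wronskian_def by (simp add: z1 z2 algebra_simps)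
  then have "(m11 * m22 - m12 * m21)\<^sup>2 = 1"
    using wy wz by (simp add: abs_mult abs_square_eq_1)
  then have det: "a * c - b\<^sup>2 = 1"
    unfolding a_def b_def c_def by algebra
  have U: "dhl x0 (\<lambda>x. (z1 x)\<^sup>2 + (z2 x)\<^sup>2) x
      = 2 * (y1 x * (a * dhl x0 y1 x + b * dhl x0 y2 x)
           + y2 x * (b * dhl x0 y1 x + c * dhl x0 y2 x))" if "x0 \<le> x" for x
    unfolding dhl_sum_of_squares[OF z that] z1[OF that] z2[OF that] a_def b_def c_def
    by algebra
  note rel = limit_relation[OF assms(2,3,4,7) U, folded w_def]
  have "0 \<le> a"
    by (simp add: a_def)
  note S = identity_from_four_directions[OF wy det this rel]
  define A :: "real ^ 2 ^ 2" where "A = vector [vector [m11, m12], vector [m21, m22]]"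
  have "transpose A ** A = mat 1"
    using S unfolding A_def a_def b_def c_def
    by (simp add: vec_eq_iff forall_2 matrix_matrix_mult_def transpose_def mat_def sum_2
        power2_eq_square mult_ac)
  moreover have "(vector [z1 x, z2 x] :: real ^ 2) = A *v vector [y1 x, y2 x]" if "x0 \<le> x" for x
    unfolding A_def z1(1)[OF that] z2(1)[OF that]
    by (simp add: vec_eq_iff forall_2 matrix_vector_mult_def sum_2)
  ultimately show ?thesis
    by blast
qed

end
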